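(* Let $X$ be a real Hilbert space with dual $X^*$, let $G:X\to X^*$ be a (nonlinear) uniformly monotone operator, let $\chi\in X^*$ and $\eta^0\in X$. (1) Suppose that for any bounded subset $\tilde U\subset X$ the operator $G$ is Lipschitz continuous on $\tilde U$. Then $G:X\to X^*$ is bijective and, in particular, there exists a unique $\eta\in X$ with $G\eta=\chi$. Moreover, the inverse $G^{-1}:X^*\to X$ is Lipschitz continuous. (2) Let $G=G_1+G_2$, where $G_1,G_2:X\to X^*$ are uniformly monotone. Suppose that for any bounded subset $\tilde U\subset X$ the operator $G_2$ is Lipschitz continuous on $\tilde U$. Then $G_2:X\to X^*$ is bijective, and the iteration $$\eta^{n+1}=(1-s)\eta^n+sG_2^{-1}(\chi-G_1\eta^n),\qquad n=0,1,2,\dots,$$ with parameter $s>0$ and initial guess $\eta^0$, is well defined. Moreover, the inverse $G_2^{-1}:X^*\to X$ is Lipschitz continuous. (3) In addition to all the hypotheses of (1) and (2), let $U\subset X$ be a bounded, open, and convex subset such that the solution $\eta$ of $G\eta=\chi$ satisfies $\eta\in U$. Suppose that $G_1$ is Lipschitz continuous on $U$, and that $G_2$ is Fréchet differentiable on $U$ with Lipschitz continuous Fréchet derivative $G_2':U\to S(X,X^* )$. Then, for sufficiently small $s>0$ and $\eta^0$ close enough to $\eta$ (i.e. there is $s_0>0$ such that for every $s\in(0,s_0)$ there is $\delta>0$ such that for every $\eta^0\in X$ with $\|\eta^0-\eta\|_X<\delta$), the iteration in (2) converges to $\eta$, and the convergence is linear, i.e., there exist constants $C>0$ and $0\le L<1$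 such that $$\|\eta^n-\eta\|_X\le CL^n\|\eta^0-\eta\|_X\qquad\text{for all } n\ge 0.$$
   Context: $\langle\cdot,\cdot\rangle$ is the dual pairing on $X^*\times X$. $B(X,X^* )$ is the space of bounded linear operators $X\to X^*$ with the operator norm, and $S(X,X^* )\subset B(X,X^* )$ is the subspace of symmetric ones, i.e. those $P$ with $\langle P\mu,\lambda\rangle=\langle P\lambda,\mu\rangle$ for all $\mu,\lambda\in X$. A (nonlinear) operator $G:X\to X^*$ is uniformly monotone if there is a constant $c>0$ such that $\langle G\mu-G\lambda,\mu-\lambda\rangle\ge c\|\mu-\lambda\|_X^2$ for all $\mu,\lambda\in X$. It is Lipschitz continuous on $U\subset X$ if there is $C>0$ (which may depend on $U$) with $\|G\mu-G\lambda\|_{X^*}\le C\|\mu-\lambda\|_X$ for all $\mu,\lambda\in U$; Lipschitz continuity of other maps between normed spaces is defined in the same way. *)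

theory Defs
  imports "HOL-Analysis.Analysis"
begin

text \<open>
  A real Hilbert space X is a type of class \<open>{real_inner, complete_space}\<close>. Its dual is the
  type \<open>'a \<Rightarrow>\<^sub>L real\<close> with the operator norm, the pairing of \<open>f\<close> with \<open>x\<close> is \<open>blinfun_apply f x\<close>,
  and B(X,X*) is the type \<open>'a \<Rightarrow>\<^sub>L 'a \<Rightarrow>\<^sub>L real\<close>.
\<close>

definition symmetric_operators :: "('a::real_normed_vector \<Rightarrow>\<^sub>L 'a \<Rightarrow>\<^sub>L real) set" where
  "symmetric_operators =
    {P. \<forall>x y. blinfun_apply (blinfun_apply P x) y = blinfun_apply (blinfun_apply P y) x}"

definition uniformly_monotone :: "('a::real_normed_vector \<Rightarrow> 'a \<Rightarrow>\<^sub>L real) \<Rightarrow> bool" where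
  "uniformly_monotone G \<longleftrightarrow>
    (\<exists>c>0. \<forall>x y. blinfun_apply (G x - G y) (x - y) \<ge> c * (norm (x - y))\<^sup>2)"

definition Lipschitz_continuous_on ::
    "'a::real_normed_vector set \<Rightarrow> ('a \<Rightarrow> 'b::real_normed_vector) \<Rightarrow> bool" where
  "Lipschitz_continuous_on U f \<longleftrightarrow> (\<exists>C>0. C-lipschitz_on U f)"

definition Lipschitz_continuous_on_bounded_sets ::
    "('a::real_normed_vector \<Rightarrow> 'b::real_normed_vector) \<Rightarrow> bool" where
  "Lipschitz_continuous_on_bounded_sets f \<longleftrightarrow> (\<forall>V. bounded V \<longrightarrow> Lipschitz_continuous_on V f)"

text \<open>
  Since \<open>inv G2\<close> is a total function, the sequence below exists for every \<open>G2\<close>. That the iteration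
  is well defined is the separate requirement that at every step the point at which the inverse is
  evaluated has exactly one preimage under \<open>G2\<close>.
\<close>

primrec iteration ::
    "('a::real_normed_vector \<Rightarrow> 'a \<Rightarrow>\<^sub>L real) \<Rightarrow> ('a \<Rightarrow> 'a \<Rightarrow>\<^sub>L real) \<Rightarrow> ('a \<Rightarrow>\<^sub>L real) \<Rightarrow>
      real \<Rightarrow> 'a \<Rightarrow> nat \<Rightarrow> 'a" where
  "iteration G1 G2 chi s \<eta>0 0 = \<eta>0"
| "iteration G1 G2 chi s \<eta>0 (Suc n) =
    (1 - s) *\<^sub>R iteration G1 G2 chi s \<eta>0 n
      + s *\<^sub>R inv G2 (chi - G1 (iteration G1 G2 chi s \<eta>0 n))"

definition iteration_well_defined ::
    "('a::real_normed_vector \<Rightarrow> 'a \<Rightarrow>\<^sub>L real) \<Rightarrow> ('a \<Rightarrow> 'a \<Rightarrow>\<^sub>L real) \<Rightarrow> ('a \<Rightarrow>\<^sub>L real) \<Rightarrow>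
      real \<Rightarrow> 'a \<Rightarrow> bool" where
  "iteration_well_defined G1 G2 chi s \<eta>0 \<longleftrightarrow>
    (\<forall>n. \<exists>!\<zeta>. G2 \<zeta> = chi - G1 (iteration G1 G2 chi s \<eta>0 n))"

end

theory Submission
  imports Defs
begin

text \<open>
  Existence is reduced to Banach's fixed point theorem. Through the Riesz isomorphism \<open>R\<close> the
  equation \<open>G x = chi\<close> says that \<open>x\<close> is a fixed point of \<open>T x = x - t R (G x - chi)\<close>. For
  \<open>G\<close> monotone with constant \<open>c\<close> and \<open>C\<close>-Lipschitz on a ball, expanding the square gives the
  factor \<open>1 - 2 t c + t\<^sup>2 C\<^sup>2\<close> for \<open>T\<close> there, which is below 1 for small \<open>t\<close>. Since \<open>C\<close> depends on
  the ball, the ball has to be chosen first, in such a way that \<open>T\<close> maps it to itself for every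
  small \<open>t\<close>; radius \<open>2 \<parallel>G 0 - chi\<parallel> / c\<close> is large enough
  (\<open>uniformly_monotone_surj\<close>). Injectivity and the Lipschitz constant \<open>1 / c\<close> of the inverse are
  read off from the monotonicity inequality and the bound of the pairing by the norms.

  For the convergence of the iteration, put \<open>P = G2' \<eta>\<close>. This operator is symmetric and inherits
  from \<open>G2\<close> the bound \<open>\<langle>P h, h\<rangle> \<ge> c \<parallel>h\<parallel>\<^sup>2\<close>, so that \<open>\<langle>P h, h\<rangle>\<close> is the square of a norm equivalent to the
  given one. Let \<open>e\<close> be the current error and \<open>d = G2\<^sup>-\<^sup>1 (chi - G1 (\<eta> + e)) - \<eta>\<close>, so that the next
  error is \<open>(1 - s) e + s d\<close>. By definition of \<open>d\<close> and \<open>\<eta>\<close>,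
  \<open>G2 (\<eta> + d) - G2 \<eta> = - (G1 (\<eta> + e) - G1 \<eta>)\<close>. Hence \<open>\<parallel>d\<parallel>\<close> is at most a multiple of \<open>\<parallel>e\<parallel>\<close>, and
  \<open>\<langle>P d, e\<rangle>\<close> equals \<open>- \<langle>G1 (\<eta> + e) - G1 \<eta>, e\<rangle> \<le> - c \<parallel>e\<parallel>\<^sup>2\<close> up to the error of linearising \<open>G2\<close> at
  \<open>\<eta>\<close>, which is of smaller order. So \<open>\<langle>P d, e\<rangle> \<le> 0\<close> for small \<open>e\<close>. Measured by \<open>P\<close>, the mixed term
  in the square of the next error is therefore harmless, and this square decreases by the factor
  \<open>(1 - s)\<^sup>2 + O(s\<^sup>2) < 1\<close> for small \<open>s\<close>. Monotone decrease in the \<open>P\<close>-norm also keeps all iterates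
  in the neighbourhood of \<open>\<eta>\<close> where the estimate holds.
\<close>

section \<open>Riesz representation\<close>

text \<open>
  The representing vector is the minimiser of \<open>J x = \<parallel>x\<parallel>\<^sup>2 / 2 - f x\<close>. The parallelogram law makes
  every minimising sequence Cauchy, and the derivative of \<open>J\<close> vanishes at its limit.
\<close>

lemma Riesz_representation:
  fixes f :: "'a::{real_inner, complete_space} \<Rightarrow>\<^sub>L real"
  obtains z where "\<And>h. blinfun_apply f h = z \<bullet> h"
proof -
  define J where "J x = (x \<bullet> x) / 2 - f x" for x :: 'a
  have lower: "J x \<ge> - (norm f)\<^sup>2 / 2" for x
  proof -
    have "f x \<le> norm f * norm x"
      using norm_blinfun[of f x] by simp
    moreover have "0 \<le> (norm f - norm x)\<^sup>2" by simp
    ultimately show ?thesis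
      unfolding J_def dot_square_norm by (simp add: power2_eq_square algebra_simps)
  qed
  define m where "m = Inf (range J)"
  have bdd: "bdd_below (range J)"
    using lower by (intro bdd_belowI2)
  have m_le: "m \<le> J x" for x
    unfolding m_def by (rule cInf_lower[OF _ bdd]) simp
  define i where "i n = inverse (real (Suc n))" for n
  have i_pos: "i n > 0" for n
    unfolding i_def by simp
  have "\<exists>x. J x < m + i n" for n
    using cInf_lessD[of "range J" "m + i n"] i_pos[of n] unfolding m_def by auto
  then obtain X where X: "J (X n) < m + i n" for n
    by metis
  have parallelogram: "(norm (x - y))\<^sup>2 = 4 * (J x + J y - 2 * J ((1/2) *\<^sub>R (x + y)))" for x y
    unfolding J_def power2_norm_eq_inner
    by (simp add: blinfun.bilinear_simps algebra_simps inner_commute)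
  have close: "(norm (X k - X l))\<^sup>2 < 8 * i n" if "n \<le> k" "n \<le> l" for k l n
  proof -
    have "i k \<le> i n" "i l \<le> i n"
      unfolding i_def using that by (auto simp del: of_nat_Suc intro!: le_imp_inverse_le)
    then show ?thesis
      using X[of k] X[of l] m_le[of "(1/2) *\<^sub>R (X k + X l)"] unfolding parallelogram by argo
  qed
  have "Cauchy X"
  proof (rule metric_CauchyI)
    fix \<epsilon> :: real assume "\<epsilon> > 0"
    then have "\<epsilon>\<^sup>2 / 8 > 0" by simp
    then obtain n where n: "i n < \<epsilon>\<^sup>2 / 8"
      unfolding i_def using reals_Archimedean by blast
    have "dist (X k) (X l) < \<epsilon>" if "k \<ge> n" "l \<ge> n" for k l
    proof (rule power2_less_imp_less)
      show "(dist (X k) (X l))\<^sup>2 < \<epsilon>\<^sup>2"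
        using close[OF that] n by (simp add: dist_norm)
    qed (use \<open>\<epsilon> > 0\<close> in simp)
    then show "\<exists>M. \<forall>k\<ge>M. \<forall>l\<ge>M. dist (X k) (X l) < \<epsilon>" by blast
  qed
  then obtain z where z: "X \<longlonglongrightarrow> z"
    using Cauchy_convergent convergent_def by blast
  have "(\<lambda>n. J (X n)) \<longlonglongrightarrow> J z"
    unfolding J_def by (intro tendsto_intros z) auto
  moreover have "(\<lambda>n. m + i n) \<longlonglongrightarrow> m + 0"
    unfolding i_def by (intro tendsto_intros LIMSEQ_inverse_real_of_nat)
  ultimately have "J z \<le> m"
    using X by (intro LIMSEQ_le[of _ "J z" _ m]) (auto dest: less_imp_le)
  then have min: "J z \<le> J x" for x
    using m_le order_trans by blast
  have "f h = z \<bullet> h" for h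
  proof -
    define a where "a = z \<bullet> h - f h"
    have quad: "0 \<le> t * a + t\<^sup>2 * (h \<bullet> h) / 2" for t
      using min[of "z + t *\<^sub>R h"] unfolding J_def a_def
      by (simp add: blinfun.bilinear_simps algebra_simps inner_commute power2_eq_square)
    \<comment> \<open>The denominator is increased by 1 so that \<open>h = 0\<close> is included.\<close>
    define b where "b = h \<bullet> h + 1"
    have b: "b > 0" "h \<bullet> h \<le> b"
      unfolding b_def by (simp_all add: add_nonneg_pos)
    have "0 \<le> (- a / b) * a + (- a / b)\<^sup>2 * (h \<bullet> h) / 2"
      by (rule quad)
    also have "\<dots> \<le> (- a / b) * a + (- a / b)\<^sup>2 * b / 2"
      using b by (intro add_left_mono divide_right_mono mult_left_mono) auto
    also have "\<dots> = - (a\<^sup>2 / (2 * b))"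
      using b by (simp add: field_simps power2_eq_square)
    finally have "a\<^sup>2 / (2 * b) \<le> 0" by simp
    then have "a = 0"
      using b by (simp add: divide_le_0_iff)
    then show ?thesis unfolding a_def by simp
  qed
  then show ?thesis by (rule that)
qed

section \<open>Uniformly monotone operators\<close>

lemma uniformly_monotoneE:
  assumes "uniformly_monotone G"
  obtains c where "c > 0" "\<And>x y. c * (norm (x - y))\<^sup>2 \<le> blinfun_apply (G x - G y) (x - y)"
  using assms unfolding uniformly_monotone_def by blast

lemma blinfun_pairing_bound:
  fixes f :: "'a::real_normed_vector \<Rightarrow>\<^sub>L real"
  shows "\<bar>f x\<bar> \<le> norm f * norm x"
  using norm_blinfun[of f x] by simp

lemma monotone_expansive:
  fixes G :: "'a::real_normed_vector \<Rightarrow> 'a \<Rightarrow>\<^sub>L real"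
  assumes mono: "\<And>x y. c * (norm (x - y))\<^sup>2 \<le> blinfun_apply (G x - G y) (x - y)"
  shows "c * norm (x - y) \<le> norm (G x - G y)"
proof (cases "x = y")
  case False
  have "c * norm (x - y) * norm (x - y) \<le> norm (G x - G y) * norm (x - y)"
    using mono[of x y] blinfun_pairing_bound[of "G x - G y" "x - y"]
    by (simp add: power2_eq_square mult.assoc)
  then show ?thesis
    using False by simp
qed simp

text \<open>
  To be used with \<open>u\<close> and \<open>v\<close> the Riesz representatives of \<open>G x - chi\<close> and \<open>G y - chi\<close>.
  Expanding the square, monotonicity bounds the mixed term and the Lipschitz condition the last one.
\<close>

lemma monotone_step_contraction:
  fixes x y :: "'a::real_inner"
  assumes mono: "c * (norm (x - y))\<^sup>2 \<le> (u - v) \<bullet> (x - y)"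
    and lip: "norm (u - v) \<le> C * norm (x - y)"
    and t: "t \<ge> 0"
  shows "(norm ((x - t *\<^sub>R u) - (y - t *\<^sub>R v)))\<^sup>2 \<le> (1 - 2 * t * c + t\<^sup>2 * C\<^sup>2) * (norm (x - y))\<^sup>2"
proof -
  have "(norm ((x - t *\<^sub>R u) - (y - t *\<^sub>R v)))\<^sup>2
      = (norm (x - y))\<^sup>2 - 2 * t * ((u - v) \<bullet> (x - y)) + t\<^sup>2 * (norm (u - v))\<^sup>2"
    unfolding power2_norm_eq_inner
    by (simp add: algebra_simps inner_commute power2_eq_square)
  also have "\<dots> \<le> (norm (x - y))\<^sup>2 - 2 * t * (c * (norm (x - y))\<^sup>2) + t\<^sup>2 * (C * norm (x - y))\<^sup>2"
    using t by (intro add_mono diff_mono mult_left_mono mono power_mono lip) auto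
  finally show ?thesis
    by (simp add: algebra_simps power_mult_distrib)
qed

lemma uniformly_monotone_surj:
  fixes G :: "'a::{real_inner, complete_space} \<Rightarrow> 'a \<Rightarrow>\<^sub>L real"
  assumes "uniformly_monotone G" and "Lipschitz_continuous_on_bounded_sets G"
  shows "surj G"
proof -
  obtain c where c: "c > 0"
    and mono: "\<And>x y. c * (norm (x - y))\<^sup>2 \<le> blinfun_apply (G x - G y) (x - y)"
    using assms(1) by (rule uniformly_monotoneE) blast
  have "\<exists>x. G x = chi" for chi
  proof -
    define r where "r = 2 * norm (G 0 - chi) / c"
    have r: "r \<ge> 0" unfolding r_def using c by simp
    have "Lipschitz_continuous_on (cball 0 r) G"
      using assms(2) bounded_cball unfolding Lipschitz_continuous_on_bounded_sets_def by blast
    then obtain C0 where "C0-lipschitz_on (cball 0 r) G"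
      unfolding Lipschitz_continuous_on_def by blast
    \<comment> \<open>Enlarging the constant to \<open>C \<ge> c\<close> keeps the contraction factor \<open>q\<close> below nonnegative,
      even on a ball that is a single point.\<close>
    then obtain C where lip: "C-lipschitz_on (cball 0 r) G" and C: "C \<ge> c"
      by (meson lipschitz_on_le max.cobounded1 max.cobounded2)
    have "\<exists>z. \<forall>h. blinfun_apply (G x - chi) h = z \<bullet> h" for x
      by (meson Riesz_representation)
    then obtain g where g: "\<And>x h. blinfun_apply (G x - chi) h = g x \<bullet> h"
      by metis
    have g_diff: "(g x - g y) \<bullet> h = blinfun_apply (G x - G y) h" for x y h
      using g[of x h] g[of y h] by (simp add: inner_diff_left blinfun.diff_left)
    have norm_le_of_pairing: "norm z \<le> norm f"
      if "\<And>h. z \<bullet> h = blinfun_apply f h" for z and f :: "'a \<Rightarrow>\<^sub>L real"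
    proof (cases "z = 0")
      case False
      have "norm z * norm z \<le> norm f * norm z"
        using that[of z] blinfun_pairing_bound[of f z]
        by (simp flip: power2_eq_square add: power2_norm_eq_inner)
      then show ?thesis using False by simp
    qed simp
    \<comment> \<open>The value of \<open>t\<close> that minimises \<open>1 - 2 t c + t\<^sup>2 C\<^sup>2\<close>; the minimum \<open>1 - t c\<close> is at
      most \<open>q\<^sup>2\<close>.\<close>
    define t where "t = c / C\<^sup>2"
    have t: "t > 0" unfolding t_def using c C by simp
    have tC: "t\<^sup>2 * C\<^sup>2 = t * c"
      unfolding t_def using C c by (simp add: field_simps power2_eq_square)
    have "c * c \<le> C * C" using C c by (intro mult_mono) auto
    then have tc: "t * c \<le> 1"
      unfolding t_def using c C by (simp add: power2_eq_square)
    define q where "q = 1 - t * c / 2"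
    have q: "0 \<le> q" "q < 1" using tc t c unfolding q_def by auto
    define T where "T x = x - t *\<^sub>R g x" for x
    have contr: "dist (T x) (T y) \<le> q * dist x y"
      if "x \<in> cball 0 r" "y \<in> cball 0 r" for x y
    proof -
      have "norm (g x - g y) \<le> norm (G x - G y)"
        using g_diff by (rule norm_le_of_pairing)
      also have "\<dots> \<le> C * norm (x - y)"
        using lipschitz_onD[OF lip that] by (simp add: dist_norm)
      finally have "(norm (T x - T y))\<^sup>2 \<le> (1 - 2 * t * c + t\<^sup>2 * C\<^sup>2) * (norm (x - y))\<^sup>2"
        unfolding T_def using t mono[of x y] g_diff[of x y "x - y"]
        by (intro monotone_step_contraction) auto
      also have "1 - 2 * t * c + t\<^sup>2 * C\<^sup>2 \<le> q\<^sup>2"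
        using zero_le_power2[of "t * c / 2"] unfolding q_def tC
        by (simp add: power2_eq_square algebra_simps)
      finally have "(norm (T x - T y))\<^sup>2 \<le> (q * norm (x - y))\<^sup>2"
        by (simp add: power_mult_distrib mult_right_mono)
      then show ?thesis
        unfolding dist_norm by (rule power2_le_imp_le) (use q in simp)
    qed
    \<comment> \<open>This is where the radius matters: moving \<open>0\<close> costs \<open>t \<parallel>G 0 - chi\<parallel>\<close>, which is exactly
      the room \<open>(1 - q) r\<close> left by the contraction.\<close>
    have self: "T x \<in> cball 0 r" if x: "x \<in> cball 0 r" for x
    proof -
      have "norm (T x) \<le> norm (T x - T 0) + norm (T 0)"
        using norm_triangle_ineq[of "T x - T 0" "T 0"] by simp
      also have "norm (T x - T 0) \<le> q * norm x"
        using contr[OF x, of 0] r by (simp add: dist_norm)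
      also have "\<dots> \<le> q * r"
        using x q by (intro mult_left_mono) auto
      also have "norm (T 0) \<le> t * norm (G 0 - chi)"
        unfolding T_def using t norm_le_of_pairing[OF g[of 0, symmetric]] by simp
      also have "q * r + t * norm (G 0 - chi) = r"
        unfolding q_def r_def using c by (simp add: field_simps)
      finally show ?thesis by simp
    qed
    have "\<exists>!x\<in>cball 0 r. T x = x"
      using q r self contr by (intro Banach_fix) (auto simp: complete_eq_closed)
    then obtain x where "T x = x" by blast
    then have "g x = 0" unfolding T_def using t by simp
    then have "G x - chi = 0"
      using g by (intro blinfun_eqI) simp
    then show ?thesis by auto
  qed
  then show ?thesis by (metis surjI)
qed

lemma uniformly_monotone_inj:
  assumes "uniformly_monotone G"
  shows "inj G"
proof (rule injI)
  fix x y assume eq: "G x = G y"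
  obtain c where "c > 0" and mono: "\<And>x y. c * (norm (x - y))\<^sup>2 \<le> blinfun_apply (G x - G y) (x - y)"
    using assms by (rule uniformly_monotoneE) blast
  then show "x = y"
    using monotone_expansive[of c G x y, OF mono] eq by (simp add: mult_le_0_iff)
qed

lemma uniformly_monotone_bij:
  fixes G :: "'a::{real_inner, complete_space} \<Rightarrow> 'a \<Rightarrow>\<^sub>L real"
  assumes "uniformly_monotone G" and "Lipschitz_continuous_on_bounded_sets G"
  shows "bij G"
  using assms by (intro bijI uniformly_monotone_inj uniformly_monotone_surj)

lemma uniformly_monotone_inv_Lipschitz:
  assumes G: "uniformly_monotone G" and "surj G"
  shows "Lipschitz_continuous_on UNIV (inv G)"
proof -
  obtain c where c: "c > 0" and mono: "\<And>x y. c * (norm (x - y))\<^sup>2 \<le> blinfun_apply (G x - G y) (x - y)"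
    using G by (rule uniformly_monotoneE) blast
  have "(1 / c)-lipschitz_on UNIV (inv G)"
  proof (rule lipschitz_onI)
    fix f g
    show "dist (inv G f) (inv G g) \<le> 1 / c * dist f g"
      using monotone_expansive[of c G "inv G f" "inv G g", OF mono] c \<open>surj G\<close>
      by (simp add: dist_norm surj_f_inv_f field_simps)
  qed (use c in simp)
  then show ?thesis
    unfolding Lipschitz_continuous_on_def using c by (intro exI[of _ "1 / c"]) simp
qed

section \<open>Local linear convergence of the iteration\<close>

text \<open>
  Monotonicity passes to the derivative: divide the inequality for the points \<open>x + t h\<close> and \<open>x\<close> by
  \<open>t\<^sup>2\<close>. For a fixed tolerance \<open>\<epsilon>\<close> a single small \<open>t\<close> suffices.
\<close>

lemma derivative_coercive:
  fixes G :: "'a::real_normed_vector \<Rightarrow> 'a \<Rightarrow>\<^sub>L real"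
  assumes mono: "\<And>x y. c * (norm (x - y))\<^sup>2 \<le> blinfun_apply (G x - G y) (x - y)"
    and deriv: "(G has_derivative blinfun_apply P) (at x)"
  shows "c * (norm h)\<^sup>2 \<le> blinfun_apply (blinfun_apply P h) h"
proof (rule field_le_epsilon)
  fix \<epsilon>' :: real assume "\<epsilon>' > 0"
  define b where "b = (norm h)\<^sup>2 + 1"
  have b: "b > 0" "(norm h)\<^sup>2 \<le> b"
    unfolding b_def by (simp_all add: add_nonneg_pos)
  define \<epsilon> where "\<epsilon> = \<epsilon>' / b"
  have \<epsilon>: "\<epsilon> > 0" and "\<epsilon> * (norm h)\<^sup>2 \<le> \<epsilon>'"
    unfolding \<epsilon>_def using b \<open>\<epsilon>' > 0\<close> by (simp_all add: field_simps)
  obtain \<rho> where \<rho>: "\<rho> > 0" and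
    lin: "\<And>y. norm (y - x) < \<rho> \<Longrightarrow> norm (G y - G x - blinfun_apply P (y - x)) \<le> \<epsilon> * norm (y - x)"
    using deriv \<epsilon> unfolding has_derivative_at_alt by blast
  define t where "t = \<rho> / (norm h + 1)"
  have t: "t > 0" "norm (t *\<^sub>R h) < \<rho>"
    unfolding t_def using \<rho> by (simp_all add: add_nonneg_pos pos_divide_less_eq distrib_left)
  define R where "R = G (x + t *\<^sub>R h) - G x - blinfun_apply P (t *\<^sub>R h)"
  have "t\<^sup>2 * (c * (norm h)\<^sup>2) \<le> blinfun_apply (G (x + t *\<^sub>R h) - G x) (t *\<^sub>R h)"
    using mono[of "x + t *\<^sub>R h" x] by (simp add: power_mult_distrib mult_ac)
  also have "\<dots> = blinfun_apply R (t *\<^sub>R h) + t\<^sup>2 * blinfun_apply (blinfun_apply P h) h"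
    unfolding R_def by (simp add: blinfun.bilinear_simps power2_eq_square algebra_simps)
  also have "blinfun_apply R (t *\<^sub>R h) \<le> norm R * norm (t *\<^sub>R h)"
    using blinfun_pairing_bound[of R "t *\<^sub>R h"] by linarith
  also have "\<dots> \<le> (\<epsilon> * norm (t *\<^sub>R h)) * norm (t *\<^sub>R h)"
    unfolding R_def using lin[of "x + t *\<^sub>R h"] t by (intro mult_right_mono) auto
  also have "\<dots> = t\<^sup>2 * (\<epsilon> * (norm h)\<^sup>2)"
    by (simp add: power2_eq_square)
  also have "\<dots> \<le> t\<^sup>2 * \<epsilon>'"
    using \<open>\<epsilon> * (norm h)\<^sup>2 \<le> \<epsilon>'\<close> by (intro mult_left_mono) auto
  finally have "t\<^sup>2 * (c * (norm h)\<^sup>2) \<le> t\<^sup>2 * (blinfun_apply (blinfun_apply P h) h + \<epsilon>')"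
    by (simp add: algebra_simps)
  then show "c * (norm h)\<^sup>2 \<le> blinfun_apply (blinfun_apply P h) h + \<epsilon>'"
    using t by simp
qed

lemma blinfun_quadratic_bound:
  fixes P :: "'a::real_normed_vector \<Rightarrow>\<^sub>L 'a \<Rightarrow>\<^sub>L real"
  shows "blinfun_apply (blinfun_apply P h) h \<le> norm P * (norm h)\<^sup>2"
proof -
  have "blinfun_apply (blinfun_apply P h) h \<le> norm (blinfun_apply P h) * norm h"
    using blinfun_pairing_bound[of "blinfun_apply P h" h] by linarith
  also have "\<dots> \<le> norm P * norm h * norm h"
    by (intro mult_right_mono norm_blinfun) auto
  finally show ?thesis by (simp add: power2_eq_square mult.assoc)
qed

text \<open>
  The effect of one relaxed step on the squared \<open>P\<close>-norm of the error, with \<open>e\<close> the error and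
  \<open>d\<close> that of the unrelaxed step. Symmetry lets the two mixed terms of the square merge into a multiple of the pairing of \<open>P d\<close>
  with \<open>e\<close>, the one whose sign is known.
\<close>

lemma energy_convex_step:
  fixes P :: "'a::real_normed_vector \<Rightarrow>\<^sub>L 'a \<Rightarrow>\<^sub>L real"
  assumes sym: "P \<in> symmetric_operators"
    and cross: "blinfun_apply (blinfun_apply P d) e \<le> 0"
    and d: "blinfun_apply (blinfun_apply P d) d \<le> M * blinfun_apply (blinfun_apply P e) e"
    and s: "0 \<le> s" "s \<le> 1"
    and e': "e' = (1 - s) *\<^sub>R e + s *\<^sub>R d"
  shows "blinfun_apply (blinfun_apply P e') e'
      \<le> ((1 - s)\<^sup>2 + s\<^sup>2 * M) * blinfun_apply (blinfun_apply P e) e"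
proof -
  have "blinfun_apply (blinfun_apply P e) d = blinfun_apply (blinfun_apply P d) e"
    using sym unfolding symmetric_operators_def by blast
  then have "blinfun_apply (blinfun_apply P e') e'
      = (1 - s)\<^sup>2 * blinfun_apply (blinfun_apply P e) e
        + 2 * (s * (1 - s)) * blinfun_apply (blinfun_apply P d) e
        + s\<^sup>2 * blinfun_apply (blinfun_apply P d) d"
    unfolding e' by (simp add: blinfun.bilinear_simps power2_eq_square algebra_simps)
  also have "\<dots> \<le> (1 - s)\<^sup>2 * blinfun_apply (blinfun_apply P e) e + 0
      + s\<^sup>2 * (M * blinfun_apply (blinfun_apply P e) e)"
    using cross d s by (intro add_mono mult_left_mono mult_nonneg_nonpos) auto
  finally show ?thesis by (simp add: algebra_simps)
qed

text \<open>
  Both estimates concern \<open>d = \<zeta> - \<eta>\<close> and \<open>e = \<xi> - \<eta>\<close>. The tolerance \<open>\<epsilon>\<close> in the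
  linearisation of \<open>G2\<close> is chosen so that the linearisation error, at most
  \<open>\<epsilon> \<parallel>d\<parallel> \<parallel>e\<parallel>\<close>, is absorbed by the term \<open>c1 \<parallel>e\<parallel>\<^sup>2\<close> coming from the monotonicity of \<open>G1\<close>.
\<close>

lemma splitting_correction_bounds:
  fixes G1 G2 :: "'a::real_normed_vector \<Rightarrow> 'a \<Rightarrow>\<^sub>L real"
  assumes c1: "c1 > 0"
    and mono1: "\<And>x y. c1 * (norm (x - y))\<^sup>2 \<le> blinfun_apply (G1 x - G1 y) (x - y)"
    and c2: "c2 > 0"
    and mono2: "\<And>x y. c2 * (norm (x - y))\<^sup>2 \<le> blinfun_apply (G2 x - G2 y) (x - y)"
    and U: "open U" "\<eta> \<in> U"
    and C: "C > 0" and lip: "C-lipschitz_on U G1"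
    and deriv: "(G2 has_derivative blinfun_apply P) (at \<eta>)"
  obtains r where "r > 0"
    and "\<And>\<xi> \<zeta>. norm (\<xi> - \<eta>) < r \<Longrightarrow> G1 \<xi> + G2 \<zeta> = G1 \<eta> + G2 \<eta>
      \<Longrightarrow> norm (\<zeta> - \<eta>) \<le> C / c2 * norm (\<xi> - \<eta>)
        \<and> blinfun_apply (blinfun_apply P (\<zeta> - \<eta>)) (\<xi> - \<eta>) \<le> 0"
proof -
  define \<epsilon> where "\<epsilon> = c1 * c2 / C"
  have \<epsilon>: "\<epsilon> > 0" unfolding \<epsilon>_def using c1 c2 C by simp
  obtain \<rho> where \<rho>: "\<rho> > 0" and
    lin: "\<And>y. norm (y - \<eta>) < \<rho> \<Longrightarrow> norm (G2 y - G2 \<eta> - blinfun_apply P (y - \<eta>)) \<le> \<epsilon> * norm (y - \<eta>)"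
    using deriv \<epsilon> unfolding has_derivative_at_alt by blast
  obtain r0 where r0: "r0 > 0" "ball \<eta> r0 \<subseteq> U"
    using U open_contains_ball by blast
  define r where "r = min r0 (\<rho> * c2 / C)"
  have "r > 0" unfolding r_def using r0 \<rho> c2 C by simp
  moreover have "norm (\<zeta> - \<eta>) \<le> C / c2 * norm (\<xi> - \<eta>)
        \<and> blinfun_apply (blinfun_apply P (\<zeta> - \<eta>)) (\<xi> - \<eta>) \<le> 0"
    if \<xi>: "norm (\<xi> - \<eta>) < r" and eq: "G1 \<xi> + G2 \<zeta> = G1 \<eta> + G2 \<eta>" for \<xi> \<zeta>
  proof
    have "\<xi> \<in> U"
      using \<xi> r0 unfolding r_def by (auto simp: dist_norm norm_minus_commute)
    have G2_diff: "G2 \<zeta> - G2 \<eta> = - (G1 \<xi> - G1 \<eta>)"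
      using eq by (simp add: algebra_simps)
    have "c2 * norm (\<zeta> - \<eta>) \<le> norm (G2 \<zeta> - G2 \<eta>)"
      using mono2 by (rule monotone_expansive)
    also have "\<dots> = norm (G1 \<xi> - G1 \<eta>)"
      unfolding G2_diff by (rule norm_minus_cancel)
    also have "\<dots> \<le> C * norm (\<xi> - \<eta>)"
      using lipschitz_onD[OF lip \<open>\<xi> \<in> U\<close> U(2)] by (simp add: dist_norm)
    finally show d: "norm (\<zeta> - \<eta>) \<le> C / c2 * norm (\<xi> - \<eta>)"
      using c2 by (simp add: field_simps)
    also have "\<dots> < \<rho>"
      using \<xi> c2 C unfolding r_def by (simp add: field_simps)
    finally have small: "norm (\<zeta> - \<eta>) < \<rho>" .
    define R where "R = G2 \<zeta> - G2 \<eta> - blinfun_apply P (\<zeta> - \<eta>)"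
    have "blinfun_apply P (\<zeta> - \<eta>) = - (G1 \<xi> - G1 \<eta>) - R"
      unfolding R_def G2_diff by simp
    then have "blinfun_apply (blinfun_apply P (\<zeta> - \<eta>)) (\<xi> - \<eta>)
        = - blinfun_apply (G1 \<xi> - G1 \<eta>) (\<xi> - \<eta>) - blinfun_apply R (\<xi> - \<eta>)"
      by (simp only: blinfun.bilinear_simps)
    also have "\<dots> \<le> - (c1 * (norm (\<xi> - \<eta>))\<^sup>2) + norm R * norm (\<xi> - \<eta>)"
      using mono1[of \<xi> \<eta>] blinfun_pairing_bound[of R "\<xi> - \<eta>"] by linarith
    also have "norm R \<le> \<epsilon> * norm (\<zeta> - \<eta>)"
      unfolding R_def using lin small by blast
    also have "\<dots> \<le> \<epsilon> * (C / c2 * norm (\<xi> - \<eta>))"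
      using d \<epsilon> by (intro mult_left_mono) auto
    also have "\<dots> = c1 * norm (\<xi> - \<eta>)"
      unfolding \<epsilon>_def using c2 C by simp
    finally show "blinfun_apply (blinfun_apply P (\<zeta> - \<eta>)) (\<xi> - \<eta>) \<le> 0"
      by (simp add: power2_eq_square mult_right_mono)
  qed
  ultimately show ?thesis by (rule that)
qed

text \<open>
  The constant \<open>sqrt (K / c)\<close> is the price of passing to the \<open>P\<close>-norm at the start and back at the
  end; it is paid once, independently of \<open>n\<close>.
\<close>

lemma geometric_energy_imp_norm_bound:
  fixes P :: "'a::real_normed_vector \<Rightarrow>\<^sub>L 'a \<Rightarrow>\<^sub>L real"
  assumes c: "c > 0"
    and lower: "\<And>h. c * (norm h)\<^sup>2 \<le> blinfun_apply (blinfun_apply P h) h"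
    and upper: "\<And>h. blinfun_apply (blinfun_apply P h) h \<le> K * (norm h)\<^sup>2"
    and q: "q \<ge> 0"
    and decay: "blinfun_apply (blinfun_apply P e) e \<le> q ^ n * blinfun_apply (blinfun_apply P e0) e0"
  shows "norm e \<le> sqrt (K / c) * sqrt q ^ n * norm e0"
proof -
  have "c * (norm e)\<^sup>2 \<le> q ^ n * (K * (norm e0)\<^sup>2)"
    using lower[of e] decay mult_left_mono[OF upper[of e0], of "q ^ n"] q by simp
  then have "(norm e)\<^sup>2 \<le> K / c * q ^ n * (norm e0)\<^sup>2"
    using c by (simp add: field_simps)
  then have "sqrt ((norm e)\<^sup>2) \<le> sqrt (K / c * q ^ n * (norm e0)\<^sup>2)"
    by (rule real_sqrt_le_mono)
  then show ?thesis
    by (simp only: real_sqrt_mult real_sqrt_power real_sqrt_abs abs_norm_cancel)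
      (simp flip: real_sqrt_power)
qed

lemma iteration_locally_linearly_convergent:
  fixes G1 G2 :: "'a::real_normed_vector \<Rightarrow> 'a \<Rightarrow>\<^sub>L real"
  assumes G1: "uniformly_monotone G1" and G2: "uniformly_monotone G2" "surj G2"
    and sol: "G1 \<eta> + G2 \<eta> = chi"
    and U: "open U" "\<eta> \<in> U" "Lipschitz_continuous_on U G1"
    and deriv: "(G2 has_derivative blinfun_apply P) (at \<eta>)"
    and sym: "P \<in> symmetric_operators"
  shows "\<exists>s0>0. \<forall>s\<in>{0<..<s0}. \<exists>\<delta>>0. \<forall>\<xi>. norm (\<xi> - \<eta>) < \<delta> \<longrightarrow>
            iteration G1 G2 chi s \<xi> \<longlonglongrightarrow> \<eta>
            \<and> (\<exists>C>0. \<exists>L. 0 \<le> L \<and> L < 1 \<and>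
                 (\<forall>n. norm (iteration G1 G2 chi s \<xi> n - \<eta>) \<le> C * L ^ n * norm (\<xi> - \<eta>)))"
proof -
  obtain c1 where c1: "c1 > 0"
    and mono1: "\<And>x y. c1 * (norm (x - y))\<^sup>2 \<le> blinfun_apply (G1 x - G1 y) (x - y)"
    using G1 by (rule uniformly_monotoneE) blast
  obtain c2 where c2: "c2 > 0"
    and mono2: "\<And>x y. c2 * (norm (x - y))\<^sup>2 \<le> blinfun_apply (G2 x - G2 y) (x - y)"
    using G2(1) by (rule uniformly_monotoneE) blast
  obtain C where C: "C > 0" and lip: "C-lipschitz_on U G1"
    using U(3) unfolding Lipschitz_continuous_on_def by blast
  obtain r where r: "r > 0"
    and corr: "\<And>\<xi> \<zeta>. norm (\<xi> - \<eta>) < r \<Longrightarrow> G1 \<xi> + G2 \<zeta> = G1 \<eta> + G2 \<eta>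
      \<Longrightarrow> norm (\<zeta> - \<eta>) \<le> C / c2 * norm (\<xi> - \<eta>)
        \<and> blinfun_apply (blinfun_apply P (\<zeta> - \<eta>)) (\<xi> - \<eta>) \<le> 0"
    using splitting_correction_bounds[OF c1 mono1 c2 mono2 U(1,2) C lip deriv] by blast
  define E where "E h = blinfun_apply (blinfun_apply P h) h" for h
  have lower: "c2 * (norm h)\<^sup>2 \<le> E h" for h
    unfolding E_def using mono2 deriv by (rule derivative_coercive)
  \<comment> \<open>The summand 1 makes \<open>K\<close> positive also on the trivial space, where \<open>P = 0\<close>.\<close>
  define K where "K = norm P + 1"
  have K: "K > 0" unfolding K_def by (simp add: add_nonneg_pos)
  have upper: "E h \<le> K * (norm h)\<^sup>2" for h
    unfolding E_def K_def using blinfun_quadratic_bound[of P h] by (simp add: distrib_right add_increasing2)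
  define M where "M = K * (C / c2)\<^sup>2 / c2"
  have M: "M > 0" unfolding M_def using K C c2 by simp
  have step: "E ((1 - s) *\<^sub>R \<xi> + s *\<^sub>R inv G2 (chi - G1 \<xi>) - \<eta>) \<le> ((1 - s)\<^sup>2 + s\<^sup>2 * M) * E (\<xi> - \<eta>)"
    if \<xi>: "norm (\<xi> - \<eta>) < r" and s: "0 \<le> s" "s \<le> 1" for \<xi> s
  proof -
    define \<zeta> where "\<zeta> = inv G2 (chi - G1 \<xi>)"
    have "G1 \<xi> + G2 \<zeta> = G1 \<eta> + G2 \<eta>"
      unfolding \<zeta>_def sol using G2(2) by (simp add: surj_f_inv_f)
    from corr[OF \<xi> this] have d: "norm (\<zeta> - \<eta>) \<le> C / c2 * norm (\<xi> - \<eta>)"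
      and cross: "blinfun_apply (blinfun_apply P (\<zeta> - \<eta>)) (\<xi> - \<eta>) \<le> 0"
      by blast+
    have "E (\<zeta> - \<eta>) \<le> K * (norm (\<zeta> - \<eta>))\<^sup>2"
      by (rule upper)
    also have "\<dots> \<le> K * (C / c2 * norm (\<xi> - \<eta>))\<^sup>2"
      using K d by (intro mult_left_mono power_mono) auto
    also have "\<dots> = M * (c2 * (norm (\<xi> - \<eta>))\<^sup>2)"
      unfolding M_def power_mult_distrib using c2 by simp
    also have "\<dots> \<le> M * E (\<xi> - \<eta>)"
      using M lower by (intro mult_left_mono) auto
    finally have "E (\<zeta> - \<eta>) \<le> M * E (\<xi> - \<eta>)" .
    then show ?thesis
      unfolding E_def using sym cross s
      by (intro energy_convex_step[where d = "\<zeta> - \<eta>"]) (auto simp: \<zeta>_def algebra_simps)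
  qed
  \<comment> \<open>\<open>A\<close> bounds the loss in passing from \<open>norm\<close> to the \<open>P\<close>-norm and back, so an orbit that
    starts within \<open>r / A\<close> of \<open>\<eta>\<close> and does not increase in the \<open>P\<close>-norm stays within \<open>r\<close>.\<close>
  define A where "A = sqrt (K / c2)"
  have A: "A > 0" unfolding A_def using K c2 by simp
  define \<delta> where "\<delta> = r / A"
  have \<delta>: "\<delta> > 0" unfolding \<delta>_def using r A by simp
  \<comment> \<open>The energy factor \<open>(1 - s)\<^sup>2 + s\<^sup>2 M\<close> is below 1 exactly for \<open>0 < s < 2 / (1 + M)\<close>; half of this
    bound also gives \<open>s \<le> 1\<close>.\<close>
  define s0 where "s0 = 1 / (1 + M)"
  have s0: "s0 > 0" "s0 \<le> 1" unfolding s0_def using M by simp_all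
  have conv: "iteration G1 G2 chi s \<xi> \<longlonglongrightarrow> \<eta>
            \<and> (\<exists>C>0. \<exists>L. 0 \<le> L \<and> L < 1 \<and>
                 (\<forall>n. norm (iteration G1 G2 chi s \<xi> n - \<eta>) \<le> C * L ^ n * norm (\<xi> - \<eta>)))"
    if s: "s \<in> {0<..<s0}" and \<xi>: "norm (\<xi> - \<eta>) < \<delta>" for s \<xi>
  proof -
    define q where "q = (1 - s)\<^sup>2 + s\<^sup>2 * M"
    have "s * (1 + M) < 1"
      using s M unfolding s0_def by (simp add: field_simps)
    then have "s * (s * (1 + M)) < s * 1"
      using s by (intro mult_strict_left_mono) auto
    moreover have "q = 1 - 2 * s + s * (s * (1 + M))"
      unfolding q_def by (simp add: power2_eq_square algebra_simps)
    ultimately have "q < 1" using s by simp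
    have "q \<ge> 0" unfolding q_def using M by simp
    define X where "X = iteration G1 G2 chi s \<xi>"
    define L where "L = sqrt q"
    have L: "0 \<le> L" "L < 1" unfolding L_def using \<open>q \<ge> 0\<close> \<open>q < 1\<close> by simp_all
    have bound_of_decay: "norm (X n - \<eta>) \<le> A * L ^ n * norm (\<xi> - \<eta>)"
      if "E (X n - \<eta>) \<le> q ^ n * E (\<xi> - \<eta>)" for n
      unfolding A_def L_def
      using c2 lower upper \<open>q \<ge> 0\<close> that unfolding E_def by (rule geometric_energy_imp_norm_bound)
    \<comment> \<open>The induction hypothesis also keeps \<open>X n\<close> within distance \<open>r\<close> of \<open>\<eta>\<close>.\<close>
    have decay: "E (X n - \<eta>) \<le> q ^ n * E (\<xi> - \<eta>)" for n
    proof (induction n)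
      case 0
      show ?case unfolding X_def by simp
    next
      case (Suc n)
      have "norm (X n - \<eta>) \<le> A * L ^ n * norm (\<xi> - \<eta>)"
        using Suc.IH by (rule bound_of_decay)
      also have "\<dots> \<le> A * 1 * norm (\<xi> - \<eta>)"
        using A L by (intro mult_right_mono mult_left_mono power_le_one) auto
      also have "\<dots> < r"
        using \<xi> A unfolding \<delta>_def by (simp add: field_simps)
      finally have "E (X (Suc n) - \<eta>) \<le> q * E (X n - \<eta>)"
        unfolding X_def iteration.simps q_def using s s0 by (intro step) auto
      also have "\<dots> \<le> q * (q ^ n * E (\<xi> - \<eta>))"
        using Suc.IH \<open>q \<ge> 0\<close> by (rule mult_left_mono)
      finally show ?case by simp
    qed
    have bound: "norm (X n - \<eta>) \<le> A * L ^ n * norm (\<xi> - \<eta>)" for n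
      using decay by (rule bound_of_decay)
    have "(\<lambda>n. A * L ^ n * norm (\<xi> - \<eta>)) \<longlonglongrightarrow> 0"
      using L by (intro tendsto_mult_left_zero tendsto_mult_right_zero LIMSEQ_power_zero) simp
    moreover have "\<forall>\<^sub>F n in sequentially. norm (X n - \<eta>) \<le> A * L ^ n * norm (\<xi> - \<eta>)"
      using bound by (intro always_eventually allI)
    ultimately have "(\<lambda>n. X n - \<eta>) \<longlonglongrightarrow> 0"
      by (rule Lim_null_comparison[rotated])
    then have "X \<longlonglongrightarrow> \<eta>"
      by (simp add: LIM_zero_iff)
    then show ?thesis
      using A L bound unfolding X_def by blast
  qed
  show ?thesis
    using s0(1) \<delta> conv by blast
qed

section \<open>Solvability, inverse and convergence for monotone splittings\<close>

theorem theorem2p1: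
  fixes G G1 G2 :: "'a::{real_inner, complete_space} \<Rightarrow> 'a \<Rightarrow>\<^sub>L real"
    and G2' :: "'a \<Rightarrow> 'a \<Rightarrow>\<^sub>L 'a \<Rightarrow>\<^sub>L real"
    and chi :: "'a \<Rightarrow>\<^sub>L real"
    and \<eta> \<eta>0 :: 'a
    and U :: "'a set"
  assumes "uniformly_monotone G"
  shows
    "(Lipschitz_continuous_on_bounded_sets G
        \<longrightarrow> bij G \<and> (\<exists>!x. G x = chi) \<and> Lipschitz_continuous_on UNIV (inv G))
     \<and>
     (G = (\<lambda>x. G1 x + G2 x) \<and> uniformly_monotone G1 \<and> uniformly_monotone G2
        \<and> Lipschitz_continuous_on_bounded_sets G2
        \<longrightarrow> bij G2
          \<and> (\<forall>s>0. iteration_well_defined G1 G2 chi s \<eta>0)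
          \<and> Lipschitz_continuous_on UNIV (inv G2))
     \<and>
     (Lipschitz_continuous_on_bounded_sets G
        \<and> G = (\<lambda>x. G1 x + G2 x) \<and> uniformly_monotone G1 \<and> uniformly_monotone G2
        \<and> Lipschitz_continuous_on_bounded_sets G2
        \<and> bounded U \<and> open U \<and> convex U \<and> G \<eta> = chi \<and> \<eta> \<in> U
        \<and> Lipschitz_continuous_on U G1
        \<and> (\<forall>x\<in>U. (G2 has_derivative blinfun_apply (G2' x)) (at x))
        \<and> (\<forall>x\<in>U. G2' x \<in> symmetric_operators)
        \<and> Lipschitz_continuous_on U G2'
        \<longrightarrow> (\<exists>s0>0. \<forall>s\<in>{0<..<s0}. \<exists>\<delta>>0. \<forall>\<xi>. norm (\<xi> - \<eta>) < \<delta> \<longrightarrow>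
              iteration G1 G2 chi s \<xi> \<longlonglongrightarrow> \<eta>
              \<and> (\<exists>C>0. \<exists>L. 0 \<le> L \<and> L < 1 \<and>
                   (\<forall>n. norm (iteration G1 G2 chi s \<xi> n - \<eta>) \<le> C * L ^ n * norm (\<xi> - \<eta>)))))"
proof (intro conjI impI)
  assume "Lipschitz_continuous_on_bounded_sets G"
  with assms show bij: "bij G"
    by (rule uniformly_monotone_bij)
  then show "\<exists>!x. G x = chi"
    by (simp add: bij_iff)
  show "Lipschitz_continuous_on UNIV (inv G)"
    using assms bij by (intro uniformly_monotone_inv_Lipschitz bij_is_surj)
next
  assume hyps: "G = (\<lambda>x. G1 x + G2 x) \<and> uniformly_monotone G1 \<and> uniformly_monotone G2
    \<and> Lipschitz_continuous_on_bounded_sets G2"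
  then show bij: "bij G2"
    by (intro uniformly_monotone_bij) auto
  then show "\<forall>s>0. iteration_well_defined G1 G2 chi s \<eta>0"
    unfolding iteration_well_defined_def by (simp add: bij_iff)
  show "Lipschitz_continuous_on UNIV (inv G2)"
    using hyps bij by (intro uniformly_monotone_inv_Lipschitz bij_is_surj) auto
next
  assume hyps: "Lipschitz_continuous_on_bounded_sets G
    \<and> G = (\<lambda>x. G1 x + G2 x) \<and> uniformly_monotone G1 \<and> uniformly_monotone G2
    \<and> Lipschitz_continuous_on_bounded_sets G2
    \<and> bounded U \<and> open U \<and> convex U \<and> G \<eta> = chi \<and> \<eta> \<in> U
    \<and> Lipschitz_continuous_on U G1
    \<and> (\<forall>x\<in>U. (G2 has_derivative blinfun_apply (G2' x)) (at x))
    \<and> (\<forall>x\<in>U. G2' x \<in> symmetric_operators)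
    \<and> Lipschitz_continuous_on U G2'"
  then have "surj G2"
    by (intro uniformly_monotone_surj) auto
  moreover have "G1 \<eta> + G2 \<eta> = chi"
    using hyps by auto
  ultimately show "\<exists>s0>0. \<forall>s\<in>{0<..<s0}. \<exists>\<delta>>0. \<forall>\<xi>. norm (\<xi> - \<eta>) < \<delta> \<longrightarrow>
      iteration G1 G2 chi s \<xi> \<longlonglongrightarrow> \<eta>
      \<and> (\<exists>C>0. \<exists>L. 0 \<le> L \<and> L < 1 \<and>
           (\<forall>n. norm (iteration G1 G2 chi s \<xi> n - \<eta>) \<le> C * L ^ n * norm (\<xi> - \<eta>)))"
    using hyps by (intro iteration_locally_linearly_convergent[where U = U and P = "G2' \<eta>"]) blast+
qed

end
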